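(* There exist infinitely many positive integers $n$ such that there is a (simple) $n$-vertex RAC$_1$ graph with exactly $5n-10$ edges.
   Context: Graphs are simple. A $1$-bend right-angle-crossing drawing (RAC$_1$ drawing) of a graph is a drawing in the plane in which vertices are mapped to distinct points, each edge is drawn as a polygonal curve between its endpoints with at most one bend (and not passing through any other vertex), and whenever two edges cross, they cross at a right angle ($90^\circ$). A graph is a RAC$_1$ graph if it admits a RAC$_1$ drawing. *)

theory Defs
  imports "HOL-Analysis.Analysis"
begin

type_synonym pt = "real \<times> real"

definition simple_graph :: "nat \<Rightarrow> nat set set \<Rightarrow> bool" where
  "simple_graph n E \<longleftrightarrow> E \<subseteq> {{u, v} | u v. u \<noteq> v \<and> u < n \<and> v < n}"

definition perp :: "pt \<Rightarrow> pt \<Rightarrow> bool" where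
  "perp a c \<longleftrightarrow> fst a * fst c + snd a * snd c = 0"

text \<open>Edge e (a 2-set of vertices) drawn with vertex positions p and bend point b e
  as the polygonal curve p u -- b e -- p v.\<close>
definition edge_curve :: "(nat \<Rightarrow> pt) \<Rightarrow> (nat set \<Rightarrow> pt) \<Rightarrow> nat set \<Rightarrow> pt set" where
  "edge_curve p b e = (\<Union>u\<in>e. closed_segment (p u) (b e))"

definition rac1_drawing :: "nat \<Rightarrow> nat set set \<Rightarrow> (nat \<Rightarrow> pt) \<Rightarrow> (nat set \<Rightarrow> pt) \<Rightarrow> bool" where
  "rac1_drawing n E p b \<longleftrightarrow>
     inj_on p {..<n} \<and>
     (\<forall>e\<in>E. \<forall>w<n. w \<notin> e \<longrightarrow> p w \<notin> edge_curve p b e) \<and>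
     (\<forall>e\<in>E. \<forall>u\<in>e. \<forall>v\<in>e. u \<noteq> v \<longrightarrow>
         closed_segment (p u) (b e) \<inter> closed_segment (b e) (p v) = {b e}) \<and>
     (\<forall>e\<in>E. \<forall>f\<in>E. e \<noteq> f \<longrightarrow>
        (\<forall>x \<in> edge_curve p b e \<inter> edge_curve p b f. x \<notin> p ` (e \<inter> f) \<longrightarrow>
           x \<noteq> b e \<and> x \<noteq> b f \<and>
           (\<exists>u\<in>e. \<exists>v\<in>f. x \<in> open_segment (p u) (b e) \<and> x \<in> open_segment (p v) (b f) \<and>
              perp (p u - b e) (p v - b f))))"

definition rac1_graph :: "nat \<Rightarrow> nat set set \<Rightarrow> bool" where
  "rac1_graph n E \<longleftrightarrow> simple_graph n E \<and> (\<exists>p b. rac1_drawing n E p b)"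

end

theory Submission
  imports Defs
begin

text \<open>
  Take a plane graph all of whose faces, the outer one included, are pentagons, and add the five
  diagonals of every face: Euler's formula gives $5n - 10$ edges.  In a pentagonal face let
  $D_i$ be the diagonal around the corner $v_i$, drawn as $v_{i-1}, b_i, v_{i+1}$.
  Only consecutive diagonals need to cross, $D_i$ and $D_{i+1}$ in the legs
  $v_{i+1} b_i$ and $v_i b_{i+1}$, so the drawing is RAC as soon as these legs are orthogonal; in
  a regular pentagon one lets every leg leave its corner at 45 degrees to the side.

  Infinitely many such graphs arise by nesting dodecahedra: the outer pentagon of one copy is the
  inner pentagon of the next one, and consecutive copies differ by the homothety with ratio $-30$.
  Edges of different copies are separated by the pentagons between the copies, so only the edges
  of a single copy have to be compared with each other, which is a finite computation with
  integers.
\<close>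


section \<open>Legs of polygonal edges\<close>

text \<open>Twice the signed area of the triangle \<open>a\<close>, \<open>b\<close>,
  \<open>c\<close>; for fixed \<open>a\<close> and \<open>b\<close> it is affine in
  \<open>c\<close>.\<close>

definition orient :: "pt \<Rightarrow> pt \<Rightarrow> pt \<Rightarrow> real" where
  "orient a b c = (fst b - fst a) * (snd c - snd a) - (snd b - snd a) * (fst c - fst a)"

lemma orient_affine: "orient a b ((1 - t) *\<^sub>R c + t *\<^sub>R d) = (1 - t) * orient a b c + t * orient a b d"
  by (simp add: orient_def algebra_simps)

lemma orient_self [simp]: "orient a b a = 0" "orient a b b = 0"
  by (simp_all add: orient_def)

lemma orient_closed_segment: "x \<in> closed_segment a b \<Longrightarrow> orient a b x = 0"
  by (auto simp: in_segment orient_affine)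

lemma segments_disjoint_if_same_side:
  assumes "0 < orient a b c \<and> 0 < orient a b d \<or> orient a b c < 0 \<and> orient a b d < 0"
  shows "closed_segment a b \<inter> closed_segment c d = {}"
proof (rule ccontr)
  assume "\<not> ?thesis"
  then obtain x where x: "x \<in> closed_segment a b" "x \<in> closed_segment c d" by blast
  obtain t where t: "0 \<le> t" "t \<le> 1" "x = (1 - t) *\<^sub>R c + t *\<^sub>R d"
    using x(2) by (auto simp: in_segment)
  have z: "(1 - t) * orient a b c + t * orient a b d = 0"
    using orient_closed_segment[OF x(1)] unfolding t(3) orient_affine .
  have "0 < (1 - t) * A + t * B" if "0 < A" "0 < B" for A B :: real
    using that t by (cases "t = 0") (auto intro!: add_nonneg_pos)
  from this[of "orient a b c" "orient a b d"] this[of "- orient a b c" "- orient a b d"] z assms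
  show False by auto
qed

lemma segments_common_endpoint:
  assumes "orient a b d \<noteq> 0" and "x \<in> closed_segment a b" and "x \<in> closed_segment a d"
  shows "x = a"
proof -
  obtain t where t: "x = (1 - t) *\<^sub>R a + t *\<^sub>R d"
    using assms(3) by (auto simp: in_segment)
  have "t * orient a b d = 0"
    using orient_closed_segment[OF assms(2)] unfolding t orient_affine by simp
  then show ?thesis using assms(1) t by simp
qed

lemma segments_cross:
  assumes "orient a b c \<noteq> 0" "orient a b d \<noteq> 0" "orient c d a \<noteq> 0" "orient c d b \<noteq> 0"
    and "x \<in> closed_segment a b" and "x \<in> closed_segment c d"
  shows "x \<in> open_segment a b" and "x \<in> open_segment c d"
  using assms orient_closed_segment[OF assms(5)] orient_closed_segment[OF assms(6)]
  by (auto simp: open_segment_def)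

text \<open>The second alternative admits straight edges, whose bend point is an interior point of
  the segment.\<close>

definition proper_bend :: "pt \<Rightarrow> pt \<Rightarrow> pt \<Rightarrow> bool" where
  "proper_bend a b c \<longleftrightarrow> orient a b c \<noteq> 0 \<or> (a - b) \<bullet> (c - b) < 0"

lemma proper_bend_inter:
  assumes "proper_bend a b c"
  shows "closed_segment a b \<inter> closed_segment b c = {b}"
proof -
  have "x = b" if x: "x \<in> closed_segment a b" "x \<in> closed_segment b c" for x
  proof (cases "orient a b c = 0")
    case False
    then have "orient b a c \<noteq> 0" by (simp add: orient_def algebra_simps)
    then show ?thesis using x segments_common_endpoint[of b a c x] by (simp add: closed_segment_commute)
  next
    case True
    then have neg: "(a - b) \<bullet> (c - b) < 0" using assms by (simp add: proper_bend_def)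
    obtain s where s: "0 \<le> s" "x - b = s *\<^sub>R (a - b)"
      using x(1) unfolding closed_segment_commute[of a b] by (auto simp: in_segment algebra_simps)
    obtain t where t: "0 \<le> t" "x - b = t *\<^sub>R (c - b)"
      using x(2) by (auto simp: in_segment algebra_simps)
    \<comment> \<open>Here \<open>x - b\<close> is a nonnegative multiple of two opposite vectors,
      so its squared norm cannot be positive.\<close>
    have "(x - b) \<bullet> (x - b) = (s * t) * ((a - b) \<bullet> (c - b))"
      by (subst (1) s(2), subst t(2)) simp
    also have "\<dots> \<le> 0" using s(1) t(1) neg by (simp add: mult_nonneg_nonpos)
    finally have "(x - b) \<bullet> (x - b) = 0" by (intro antisym inner_ge_zero)
    then show ?thesis by simp
  qed
  then show ?thesis by auto
qed

lemma proper_bend_neq: "proper_bend a b c \<Longrightarrow> a \<noteq> b" "proper_bend a b c \<Longrightarrow> c \<noteq> b"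
  by (auto simp: proper_bend_def orient_def)

section \<open>Compatible legs and a criterion for RAC drawings\<close>

lemma perp_commute: "perp a b \<longleftrightarrow> perp b a"
  by (simp add: perp_def mult.commute)

definition compatible :: "(nat \<Rightarrow> pt) \<Rightarrow> nat \<Rightarrow> pt \<Rightarrow> nat \<Rightarrow> pt \<Rightarrow> bool" where
  "compatible p u b v d \<longleftrightarrow>
     (\<forall>x \<in> closed_segment (p u) b \<inter> closed_segment (p v) d.
        u = v \<and> x = p u \<or>
        x \<in> open_segment (p u) b \<and> x \<in> open_segment (p v) d \<and> perp (p u - b) (p v - d))"

lemma compatible_commute: "compatible p u b v d \<longleftrightarrow> compatible p v d u b"
  unfolding compatible_def using perp_commute by auto

text \<open>An endpoint is not in its own open segment, so only the alternative with a common vertex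
  remains.\<close>

lemma compatible_vertex_on_leg:
  assumes "compatible p u b v d" and "p u \<in> closed_segment (p v) d"
  shows "u = v"
  using assms unfolding compatible_def open_segment_def by auto

text \<open>Since every vertex is an end of some edge, a vertex on a foreign edge is already a
  forbidden meeting of two legs. Hence, apart from the bends, only pairs of legs of different edges
  have to be compared.\<close>

lemma rac1_graph_if_compatible:
  fixes J :: "'i set" and s t :: "'i \<Rightarrow> nat" and \<beta> :: "'i \<Rightarrow> pt"
  assumes p: "inj_on p {..<n}"
    and ends: "\<And>i. i \<in> J \<Longrightarrow> s i \<noteq> t i \<and> s i < n \<and> t i < n"
    and inj: "inj_on (\<lambda>i. {s i, t i}) J"
    and bend: "\<And>i. i \<in> J \<Longrightarrow> proper_bend (p (s i)) (\<beta> i) (p (t i))"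
    and compat: "\<And>i j u v. i \<in> J \<Longrightarrow> j \<in> J \<Longrightarrow> i \<noteq> j \<Longrightarrow> u \<in> {s i, t i} \<Longrightarrow> v \<in> {s j, t j} \<Longrightarrow>
        compatible p u (\<beta> i) v (\<beta> j)"
    and covered: "\<And>w. w < n \<Longrightarrow> \<exists>i \<in> J. w \<in> {s i, t i}"
  shows "rac1_graph n ((\<lambda>i. {s i, t i}) ` J)"
proof -
  define ed where "ed = (\<lambda>i. {s i, t i})"
  \<comment> \<open>By injectivity an edge, as a 2-set, determines its index and hence its
    bend.\<close>
  define b where "b e = \<beta> (inv_into J ed e)" for e
  have inj_ed: "inj_on ed J" using inj by (simp add: ed_def)
  have b_ed: "b (ed i) = \<beta> i" if "i \<in> J" for i
    using that inj_ed by (simp add: b_def)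
  have curve: "edge_curve p b (ed i) = (\<Union>u \<in> {s i, t i}. closed_segment (p u) (\<beta> i))" if "i \<in> J" for i
    using that by (simp add: edge_curve_def b_ed) (simp add: ed_def)
  have "simple_graph n (ed ` J)"
    using ends unfolding simple_graph_def ed_def by blast
  moreover have "rac1_drawing n (ed ` J) p b"
    unfolding rac1_drawing_def
  proof (intro conjI ballI allI impI)
    show "inj_on p {..<n}" by (fact p)
  next
    fix e w assume "e \<in> ed ` J" "w < n" "w \<notin> e"
    then obtain i where i: "i \<in> J" "e = ed i" by blast
    obtain j where j: "j \<in> J" "w \<in> {s j, t j}" using covered[OF \<open>w < n\<close>] by blast
    have "i \<noteq> j" using \<open>w \<notin> e\<close> i(2) j(2) by (auto simp: ed_def)
    show "p w \<notin> edge_curve p b e"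
    proof
      assume "p w \<in> edge_curve p b e"
      then obtain u where u: "u \<in> {s i, t i}" "p w \<in> closed_segment (p u) (\<beta> i)"
        unfolding i(2) curve[OF i(1)] by blast
      have "compatible p w (\<beta> j) u (\<beta> i)" using compat j i(1) u(1) \<open>i \<noteq> j\<close> by blast
      then have "w = u" using u(2) by (rule compatible_vertex_on_leg)
      then show False using u(1) \<open>w \<notin> e\<close> i(2) by (auto simp: ed_def)
    qed
  next
    fix e u v assume "e \<in> ed ` J" "u \<in> e" "v \<in> e" "u \<noteq> v"
    then obtain i where i: "i \<in> J" "e = ed i" by blast
    have *: "closed_segment (p (s i)) (\<beta> i) \<inter> closed_segment (\<beta> i) (p (t i)) = {\<beta> i}"
      using bend[OF i(1)] by (rule proper_bend_inter)
    have "u = s i \<and> v = t i \<or> u = t i \<and> v = s i"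
      using \<open>u \<in> e\<close> \<open>v \<in> e\<close> \<open>u \<noteq> v\<close> i(2) by (auto simp: ed_def)
    then show "closed_segment (p u) (b e) \<inter> closed_segment (b e) (p v) = {b e}"
      unfolding i(2) b_ed[OF i(1)] using * by (auto simp: closed_segment_commute)
  next
    fix e f x
    assume ef: "e \<in> ed ` J" "f \<in> ed ` J" "e \<noteq> f"
      and x: "x \<in> edge_curve p b e \<inter> edge_curve p b f" and nx: "x \<notin> p ` (e \<inter> f)"
    obtain i where i: "i \<in> J" "e = ed i" using ef(1) by blast
    obtain j where j: "j \<in> J" "f = ed j" using ef(2) by blast
    have "i \<noteq> j" using ef(3) i j by blast
    obtain u where u: "u \<in> {s i, t i}" "x \<in> closed_segment (p u) (\<beta> i)"
      using x unfolding i(2) curve[OF i(1)] by blast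
    obtain v where v: "v \<in> {s j, t j}" "x \<in> closed_segment (p v) (\<beta> j)"
      using x unfolding j(2) curve[OF j(1)] by blast
    have "\<not> (u = v \<and> x = p u)"
      using nx u(1) v(1) unfolding i(2) j(2) ed_def by blast
    then have *: "x \<in> open_segment (p u) (\<beta> i)" "x \<in> open_segment (p v) (\<beta> j)"
        "perp (p u - \<beta> i) (p v - \<beta> j)"
      using compat[OF i(1) j(1) \<open>i \<noteq> j\<close> u(1) v(1)] u(2) v(2) unfolding compatible_def by blast+
    have be: "b e = \<beta> i" "b f = \<beta> j" using b_ed i j by auto
    have "u \<in> e" "v \<in> f" using u(1) v(1) i(2) j(2) by (auto simp: ed_def)
    then show "\<exists>u\<in>e. \<exists>v\<in>f. x \<in> open_segment (p u) (b e) \<and> x \<in> open_segment (p v) (b f) \<and>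
          perp (p u - b e) (p v - b f)"
      unfolding be using * by blast
    show "x \<noteq> b e" "x \<noteq> b f" unfolding be using *(1,2) by (auto simp: open_segment_def)
  qed
  ultimately show ?thesis unfolding rac1_graph_def ed_def by blast
qed

section \<open>Integer certificates\<close>

text \<open>A triple \<open>(x, y, w)\<close> of integers stands for the point \<open>(x / w, y / w)\<close>, a triple
  \<open>(A, B, C)\<close> for the affine function \<open>A x + B y + C\<close>.\<close>

type_synonym hpt = "int \<times> int \<times> int"

fun real_pt :: "hpt \<Rightarrow> pt" where
  "real_pt (x, y, w) = (real_of_int x / real_of_int w, real_of_int y / real_of_int w)"

fun weight :: "hpt \<Rightarrow> int" where
  "weight (x, y, w) = w"

text \<open>The cross product of homogeneous coordinates, so that \<open>hval (hline P Q) R\<close>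
  is the determinant of \<open>P\<close>, \<open>Q\<close>, \<open>R\<close>.\<close>

fun hline :: "hpt \<Rightarrow> hpt \<Rightarrow> hpt" where
  "hline (x, y, w) (x', y', w') = (y * w' - y' * w, x' * w - x * w', x * y' - x' * y)"

fun hval :: "hpt \<Rightarrow> hpt \<Rightarrow> int" where
  "hval (A, B, C) (x, y, w) = A * x + B * y + C * w"

fun affine_val :: "hpt \<Rightarrow> pt \<Rightarrow> real" where
  "affine_val (A, B, C) (x, y) = of_int A * x + of_int B * y + of_int C"

fun hperp :: "hpt \<Rightarrow> hpt \<Rightarrow> bool" where
  "hperp (A, B, C) (A', B', C') \<longleftrightarrow> A * A' + B * B' = 0"

fun hinner :: "hpt \<Rightarrow> hpt \<Rightarrow> hpt \<Rightarrow> int" where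
  "hinner (x, y, w) (x', y', w') (x'', y'', w'') =
     (x * w' - x' * w) * (x'' * w' - x' * w'') + (y * w' - y' * w) * (y'' * w' - y' * w'')"

text \<open>The scale \<open>r\<close> enters only as a square, so even a negative ratio preserves
  signs.\<close>

lemma orient_eq_hval:
  assumes "0 < weight P" "0 < weight Q" "0 < weight R"
  shows "orient (r *\<^sub>R real_pt P) (r *\<^sub>R real_pt Q) (r *\<^sub>R real_pt R) =
    r\<^sup>2 / (of_int (weight P) * of_int (weight Q) * of_int (weight R)) * of_int (hval (hline P Q) R)"
  using assms
  by (cases P; cases Q; cases R) (simp add: orient_def field_simps power2_eq_square)

lemma orient_sign:
  assumes "0 < weight P" "0 < weight Q" "0 < weight R" "r \<noteq> 0"
  shows "0 < orient (r *\<^sub>R real_pt P) (r *\<^sub>R real_pt Q) (r *\<^sub>R real_pt R) \<longleftrightarrow> 0 < hval (hline P Q) R"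
    and "orient (r *\<^sub>R real_pt P) (r *\<^sub>R real_pt Q) (r *\<^sub>R real_pt R) < 0 \<longleftrightarrow> hval (hline P Q) R < 0"
    and "orient (r *\<^sub>R real_pt P) (r *\<^sub>R real_pt Q) (r *\<^sub>R real_pt R) = 0 \<longleftrightarrow> hval (hline P Q) R = 0"
proof -
  define K where "K = r\<^sup>2 / (real_of_int (weight P) * of_int (weight Q) * of_int (weight R))"
  have "0 < K" using assms by (simp add: K_def)
  moreover have "orient (r *\<^sub>R real_pt P) (r *\<^sub>R real_pt Q) (r *\<^sub>R real_pt R) = K * of_int (hval (hline P Q) R)"
    unfolding K_def by (rule orient_eq_hval[OF assms(1-3)])
  ultimately show "0 < orient (r *\<^sub>R real_pt P) (r *\<^sub>R real_pt Q) (r *\<^sub>R real_pt R) \<longleftrightarrow> 0 < hval (hline P Q) R"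
    "orient (r *\<^sub>R real_pt P) (r *\<^sub>R real_pt Q) (r *\<^sub>R real_pt R) < 0 \<longleftrightarrow> hval (hline P Q) R < 0"
    "orient (r *\<^sub>R real_pt P) (r *\<^sub>R real_pt Q) (r *\<^sub>R real_pt R) = 0 \<longleftrightarrow> hval (hline P Q) R = 0"
    by (simp_all add: zero_less_mult_iff mult_less_0_iff)
qed

lemma perp_if_hperp:
  assumes "hperp (hline P Q) (hline P' Q')"
    and "0 < weight P" "0 < weight Q" "0 < weight P'" "0 < weight Q'"
  shows "perp (r *\<^sub>R real_pt P - r *\<^sub>R real_pt Q) (r *\<^sub>R real_pt P' - r *\<^sub>R real_pt Q')"
proof -
  obtain x1 y1 w1 x2 y2 w2 x3 y3 w3 x4 y4 w4
    where P: "P = (x1, y1, w1)" "Q = (x2, y2, w2)" "P' = (x3, y3, w3)" "Q' = (x4, y4, w4)"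
    by (cases P; cases Q; cases P'; cases Q') blast
  let ?N = "(y1 * w2 - y2 * w1) * (y3 * w4 - y4 * w3) + (x2 * w1 - x1 * w2) * (x4 * w3 - x3 * w4)"
  have "fst (r *\<^sub>R real_pt P - r *\<^sub>R real_pt Q) * fst (r *\<^sub>R real_pt P' - r *\<^sub>R real_pt Q') +
        snd (r *\<^sub>R real_pt P - r *\<^sub>R real_pt Q) * snd (r *\<^sub>R real_pt P' - r *\<^sub>R real_pt Q') =
        r\<^sup>2 / (of_int w1 * of_int w2 * of_int w3 * of_int w4) * real_of_int ?N"
    using assms(2-) unfolding P by (simp add: field_simps power2_eq_square)
  moreover have "?N = 0" using assms(1) unfolding P by simp
  ultimately show ?thesis unfolding perp_def by simp
qed

lemma inner_eq_hinner:
  assumes "0 < weight P" "0 < weight Q" "0 < weight R"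
  shows "(r *\<^sub>R real_pt P - r *\<^sub>R real_pt Q) \<bullet> (r *\<^sub>R real_pt R - r *\<^sub>R real_pt Q) =
    r\<^sup>2 / (of_int (weight P) * (of_int (weight Q))\<^sup>2 * of_int (weight R)) * of_int (hinner P Q R)"
  using assms
  by (cases P; cases Q; cases R) (simp add: field_simps power2_eq_square)

definition hbend_ok :: "hpt \<Rightarrow> hpt \<Rightarrow> hpt \<Rightarrow> bool" where
  "hbend_ok P Q R \<longleftrightarrow> hval (hline P Q) R \<noteq> 0 \<or> hinner P Q R < 0"

lemma proper_bend_if_hbend_ok:
  assumes "hbend_ok P Q R" "0 < weight P" "0 < weight Q" "0 < weight R" "r \<noteq> 0"
  shows "proper_bend (r *\<^sub>R real_pt P) (r *\<^sub>R real_pt Q) (r *\<^sub>R real_pt R)"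
proof -
  have "0 < r\<^sup>2 / (real_of_int (weight P) * (of_int (weight Q))\<^sup>2 * of_int (weight R))"
    using assms by simp
  then have "(r *\<^sub>R real_pt P - r *\<^sub>R real_pt Q) \<bullet> (r *\<^sub>R real_pt R - r *\<^sub>R real_pt Q) < 0
      \<longleftrightarrow> hinner P Q R < 0"
    unfolding inner_eq_hinner[OF assms(2-4)] mult_less_0_iff by simp
  then show ?thesis
    using assms(1) orient_sign(3)[OF assms(2-5)] unfolding proper_bend_def hbend_ok_def by simp
qed

text \<open>A leg \<open>(u, P, Q, L)\<close> joins vertex \<open>u\<close> at \<open>P\<close> to the bend \<open>Q\<close> along the line \<open>L\<close>.  The
  conditionals below, unlike conjunctions, are evaluated lazily by the simplifier.\<close>

type_synonym hleg = "nat \<times> hpt \<times> hpt \<times> hpt"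

definition same_side :: "int \<Rightarrow> int \<Rightarrow> bool" where
  "same_side x y = (if 0 < x then 0 < y else if x < 0 then y < 0 else False)"

fun leg_ok :: "hleg \<Rightarrow> hleg \<Rightarrow> bool" where
  "leg_ok (u, P, Q, L) (v, P', Q', L') =
     (if same_side (hval L P') (hval L Q') then True
      else if same_side (hval L' P) (hval L' Q) then True
      else if u = v then hval L Q' \<noteq> 0
      else hval L P' \<noteq> 0 \<and> hval L Q' \<noteq> 0 \<and> hval L' P \<noteq> 0 \<and> hval L' Q \<noteq> 0 \<and> hperp L L')"

text \<open>\<open>u\<close> and \<open>v\<close> are labels within a layer, \<open>u'\<close> and
  \<open>v'\<close> vertices of the whole graph, and \<open>r\<close> is the scale of the layer. A
  common point of the legs rules out both separating lines; the remaining tests do not assert that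
  the legs meet, only that a meeting is harmless.\<close>

lemma compatible_if_leg_ok:
  assumes ok: "leg_ok (u, P, Q, hline P Q) (v, P', Q', hline P' Q')"
    and w: "0 < weight P" "0 < weight Q" "0 < weight P'" "0 < weight Q'" and r: "r \<noteq> 0"
    and p: "p u' = r *\<^sub>R real_pt P" "p v' = r *\<^sub>R real_pt P'"
    and uv: "u = v \<Longrightarrow> u' = v'"
  shows "compatible p u' (r *\<^sub>R real_pt Q) v' (r *\<^sub>R real_pt Q')"
  unfolding compatible_def
proof
  let ?a = "p u'" and ?b = "r *\<^sub>R real_pt Q" and ?c = "p v'" and ?d = "r *\<^sub>R real_pt Q'"
  fix x assume x: "x \<in> closed_segment ?a ?b \<inter> closed_segment ?c ?d"
  note sign = orient_sign[OF w(1,2,3) r] orient_sign[OF w(1,2,4) r]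
    orient_sign[OF w(3,4,1) r] orient_sign[OF w(3,4,2) r]
  have "\<not> same_side (hval (hline P Q) P') (hval (hline P Q) Q')"
    using segments_disjoint_if_same_side[of ?a ?b ?c ?d] x unfolding same_side_def p
    by (auto simp: sign split: if_splits)
  moreover have "\<not> same_side (hval (hline P' Q') P) (hval (hline P' Q') Q)"
    using segments_disjoint_if_same_side[of ?c ?d ?a ?b] x unfolding same_side_def p
    by (auto simp: sign split: if_splits)
  ultimately have ok': "if u = v then hval (hline P Q) Q' \<noteq> 0
      else hval (hline P Q) P' \<noteq> 0 \<and> hval (hline P Q) Q' \<noteq> 0 \<and> hval (hline P' Q') P \<noteq> 0 \<and>
        hval (hline P' Q') Q \<noteq> 0 \<and> hperp (hline P Q) (hline P' Q')"
    using ok by (simp only: leg_ok.simps if_False split: if_splits)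
  show "u' = v' \<and> x = ?a \<or> x \<in> open_segment ?a ?b \<and> x \<in> open_segment ?c ?d \<and> perp (?a - ?b) (?c - ?d)"
  proof (cases "u = v")
    case True
    then have "orient ?a ?b ?d \<noteq> 0" using ok' by (simp add: p sign)
    moreover have "u' = v'" using True by (rule uv)
    ultimately show ?thesis using x segments_common_endpoint[of ?a ?b ?d x] by simp
  next
    case False
    then have "orient ?a ?b ?c \<noteq> 0" "orient ?a ?b ?d \<noteq> 0" "orient ?c ?d ?a \<noteq> 0" "orient ?c ?d ?b \<noteq> 0"
      using ok' by (simp_all add: p sign)
    from segments_cross[OF this] x have "x \<in> open_segment ?a ?b" "x \<in> open_segment ?c ?d" by auto
    moreover have "perp (?a - ?b) (?c - ?d)"
      unfolding p using False ok' by (intro perp_if_hperp w) simp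
    ultimately show ?thesis by simp
  qed
qed

section \<open>One dodecahedral layer\<close>

type_synonym hedge = "nat \<times> nat \<times> hpt"

text \<open>Vertices 0--4, 5--9, 10--14 and 15--19 approximate regular pentagons of radii 84, 202, 419 and
  2520, the last two turned by 36 degrees.  The ratio 6 between the outer two is essentially forced
  by the faces with a side on the outermost pentagon.\<close>

definition site :: "nat \<Rightarrow> hpt" where
  "site v =
    [(0, 84, 1), (-80, 26, 1), (-50, -68, 1), (50, -68, 1), (80, 26, 1),
     (0, 202, 1), (-192, 60, 1), (-119, -165, 1), (119, -165, 1), (192, 60, 1),
     (-240, 334, 1), (-399, -133, 1), (0, -419, 1), (399, -133, 1), (240, 334, 1),
     (0, -2520, 1), (2400, -780, 1), (1500, 2040, 1), (-1500, 2040, 1), (-2400, -780, 1)] ! v"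

text \<open>A straight edge still carries a bend point. The midpoint serves, with weight 2 because
  sites have weight 1.\<close>

fun side :: "nat \<times> nat \<Rightarrow> hedge" where
  "side (u, v) = (case (site u, site v) of ((x, y, _), (x', y', _)) \<Rightarrow> (u, v, x + x', y + y', 2))"

fun diagonals :: "nat list \<times> hpt list \<Rightarrow> hedge list" where
  "diagonals (vs, bs) =
     map (\<lambda>i. (vs ! ((i + 4) mod 5), vs ! ((i + 1) mod 5), bs ! i)) [0, 1, 2, 3, 4]"

text \<open>In each list of bends the fourth one is determined by its two neighbours through
  orthogonality, whence the large denominators.  The edge from 0 to 5 is not drawn straight because
  it would lie on one line with the edge from 12 to 15.\<close>

definition ring :: "hedge list" where
  "ring = (0, 5, 1, 143, 1) # map side
     [(0, 1), (1, 2), (2, 3), (3, 4), (4, 0), (1, 6), (2, 7), (3, 8), (4, 9),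
      (5, 10), (6, 11), (7, 12), (8, 13), (9, 14), (10, 6), (11, 7), (12, 8), (13, 9), (14, 5),
      (10, 18), (11, 19), (12, 15), (13, 16), (14, 17)] @
   concat (map diagonals
     [([1, 0, 5, 10, 6],
        [(-78, 90, 1), (-72, 130, 1), (-60, 144, 1), (-76, 130, 1), (-100, 102, 1)]),
      ([2, 1, 6, 11, 7],
        [(-125, -55, 1), (-140, -18, 1), (-146, -18, 1), (-4298, -1054, 29), (-265, -145, 2)]),
      ([3, 2, 7, 12, 8],
        [(15, -133, 1), (-15, -133, 1), (-26, -146, 1), (0, -461, 3), (26, -146, 1)]),
      ([3, 4, 9, 13, 8],
        [(125, -55, 1), (140, -18, 1), (146, -18, 1), (4298, -1054, 29), (265, -145, 2)]),
      ([4, 0, 5, 14, 9],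
        [(78, 90, 1), (72, 130, 1), (60, 144, 1), (76, 130, 1), (100, 102, 1)]),
      ([17, 18, 10, 5, 14],
        [(18, 522, 1), (-18, 522, 1), (-364, 1236, 3), (0, 1418, 3), (364, 1236, 3)]),
      ([18, 19, 11, 6, 10],
        [(-514, 186, 1), (-534, 154, 1), (-1851, 525, 4), (-29886, 9538, 89), (-1002, 381, 2)]),
      ([19, 15, 12, 7, 11],
        [(-333, -411, 1), (-310, -450, 1), (-214, -380, 1), (-8901, -8218, 29), (-315, -285, 1)]),
      ([16, 15, 12, 8, 13],
        [(333, -411, 1), (310, -450, 1), (214, -380, 1), (8901, -8218, 29), (315, -285, 1)]),
      ([17, 16, 13, 9, 14],
        [(514, 186, 1), (534, 154, 1), (1851, 525, 4), (29886, 9538, 89), (1002, 381, 2)])])"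

definition inner_cap :: "hedge list" where
  "inner_cap = diagonals ([0, 1, 2, 3, 4],
     [(0, 10, 1), (-15, 9, 1), (-14, -4, 1), (14, -4, 1), (15, 9, 1)])"

text \<open>A ring leaves the sides of its outer pentagon to the next layer; after the last ring
  they are added here, with the diagonals drawn outside.\<close>

definition outer_cap :: "hedge list" where
  "outer_cap = map side [(0, 1), (1, 2), (2, 3), (3, 4), (4, 0)] @ diagonals ([3, 2, 1, 0, 4],
     [(416, -534, 1), (-416, -534, 1), (-520, 214, 1), (0, 346, 1), (520, 214, 1)])"

text \<open>The five sides of the pentagon with vertices 0--4, nonpositive inside.\<close>

definition walls :: "hpt list" where
  "walls = [(29, 40, -3360), (-29, 40, -3360), (47, -15, -3370), (-47, -15, -3370), (0, -1, -68)]"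

text \<open>The homothety with ratio -1/30, which expresses a point in the scale of the next
  copy.\<close>

fun shrink :: "hpt \<Rightarrow> hpt" where
  "shrink (x, y, w) = (- x, - y, 30 * w)"

definition leg :: "nat \<Rightarrow> hpt \<Rightarrow> hleg" where
  "leg u Q = (u, site u, Q, hline (site u) Q)"

fun legs :: "hedge \<Rightarrow> hleg \<times> hleg" where
  "legs (u, v, Q) = (leg u Q, leg v Q)"

fun edge_ok :: "hleg \<times> hleg \<Rightarrow> hleg \<times> hleg \<Rightarrow> bool" where
  "edge_ok (k, l) (k', l') =
     (if leg_ok k k' then if leg_ok k l' then if leg_ok l k' then leg_ok l l'
      else False else False else False)"

fun pairs_ok :: "(hleg \<times> hleg) list \<Rightarrow> bool" where
  "pairs_ok [] = True"
| "pairs_ok (e # es) = (if list_all (edge_ok e) es then pairs_ok es else False)"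

text \<open>Each unordered pair is tested once, in list order; hence the disjunction.\<close>

lemma pairs_ok_map_legsD:
  assumes "pairs_ok (map legs es)" "e \<in> set es" "f \<in> set es" "e \<noteq> f"
  shows "edge_ok (legs e) (legs f) \<or> edge_ok (legs f) (legs e)"
  using assms by (induction es) (auto simp: list_all_iff split: if_splits)

text \<open>A normal form of the unordered pair of ends, so that \<open>distinct\<close> excludes
  parallel edges.\<close>

fun sorted_ends :: "hedge \<Rightarrow> nat \<times> nat" where
  "sorted_ends (u, v, Q) = (min u v, max u v)"

definition wf_edges :: "nat \<Rightarrow> hedge list \<Rightarrow> bool" where
  "wf_edges N es \<longleftrightarrow>
     list_all (\<lambda>(u, v, Q). u \<noteq> v \<and> u < N \<and> v < N \<and> 0 < weight Q \<and> hbend_ok (site u) Q (site v)) es \<and>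
     distinct (map sorted_ends es)"

definition incident :: "nat \<Rightarrow> hedge list \<Rightarrow> bool" where
  "incident j es \<longleftrightarrow> list_ex (\<lambda>(u, v, Q). j = u \<or> j = v) es"

text \<open>One wall has to serve for both ends: the half-plane behind it is convex, the complement
  of the pentagon is not.\<close>

definition leg_outside :: "hpt \<Rightarrow> hpt \<Rightarrow> bool" where
  "leg_outside P Q \<longleftrightarrow> list_ex (\<lambda>L. 0 \<le> hval L P \<and> 0 \<le> hval L Q) walls"

text \<open>Only the vertex may lie on the pentagon, not the bend, so the leg can touch the pentagon
  only at its vertex.\<close>

definition leg_inside :: "hpt \<Rightarrow> hpt \<Rightarrow> bool" where
  "leg_inside P Q \<longleftrightarrow> list_all (\<lambda>L. hval L P \<le> 0 \<and> hval L Q < 0) walls"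

section \<open>Finite verification for a single layer\<close>

lemma pairs_ok_ring: "pairs_ok (map legs ring)"
  by code_simp

lemma pairs_ok_caps: "pairs_ok (map legs inner_cap)" "pairs_ok (map legs outer_cap)"
  by code_simp+

lemma wf_ring: "wf_edges 20 ring"
  by code_simp

lemma wf_caps: "wf_edges 5 inner_cap" "wf_edges 5 outer_cap"
  by code_simp+

lemma length_layers: "length inner_cap = 5" "length ring = 75" "length outer_cap = 10"
  by code_simp+

lemma incident_layers:
  "list_all (\<lambda>j. incident j ring) [0..<15]" "list_all (\<lambda>j. incident j outer_cap) [0..<5]"
  by code_simp+

lemma ring_touches_low: "list_all (\<lambda>e. fst (sorted_ends e) < 15) ring"
  by code_simp

lemma inner_cap_ring_disjoint:
  "list_all (\<lambda>e. list_all (\<lambda>f. sorted_ends e \<noteq> sorted_ends f) ring) inner_cap"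
  by code_simp

lemma layers_outside:
  "list_all (\<lambda>(u, v, Q). leg_outside (site u) Q \<and> leg_outside (site v) Q) ring"
  "list_all (\<lambda>(u, v, Q). leg_outside (site u) Q \<and> leg_outside (site v) Q) outer_cap"
  by code_simp+

text \<open>Shrinking takes sites 15--19 to sites 0--4, so the second part places a ring inside its
  own outer pentagon.\<close>

lemma layers_inside:
  "list_all (\<lambda>(u, v, Q). leg_inside (site u) Q \<and> leg_inside (site v) Q) inner_cap"
  "list_all (\<lambda>(u, v, Q). leg_inside (shrink (site u)) (shrink Q) \<and>
     leg_inside (shrink (site v)) (shrink Q)) ring"
  by code_simp+

lemma sites_in_layer:
  "list_all (\<lambda>j. leg_outside (site j) (site j) \<and> leg_inside (shrink (site j)) (shrink (site j))) [0..<15]"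
  by code_simp

lemma weight_sites: "list_all (\<lambda>j. weight (site j) = 1) [0..<20]"
  by code_simp

lemma distinct_sites: "distinct (map site [0..<15])"
  by code_simp

lemma site_shift: "list_all (\<lambda>j. case (site j, site (15 + j)) of
    ((x, y, _), (x', y', _)) \<Rightarrow> x' = -30 * x \<and> y' = -30 * y) [0..<5]"
  by code_simp

section \<open>Nested dodecahedra\<close>

text \<open>The ratio is negative because the outer pentagon is turned by 36 degrees, which for a
  regular pentagon amounts to a half turn.\<close>

definition shift_pt :: "nat \<Rightarrow> pt \<Rightarrow> pt" where
  "shift_pt k x = ((-30) ^ k) *\<^sub>R x"

definition unshift_pt :: "nat \<Rightarrow> pt \<Rightarrow> pt" where
  "unshift_pt k x = inverse ((-30) ^ k) *\<^sub>R x"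

text \<open>A copy contributes 15 new vertices, since its sites 15--19 are the sites 0--4 of the
  next copy.\<close>

definition pos :: "nat \<Rightarrow> pt" where
  "pos v = shift_pt (v div 15) (real_pt (site (v mod 15)))"

definition layer :: "nat \<Rightarrow> nat \<Rightarrow> hedge list" where
  "layer m l = (if l = 0 then inner_cap else if l \<le> m then ring else outer_cap)"

definition edges :: "nat \<Rightarrow> (nat \<times> hedge) set" where
  "edges m = (SIGMA l : {..Suc m}. set (layer m l))"

text \<open>Truncated subtraction is intended: the inner cap 0 and the first ring 1 have the same scale.\<close>

fun src :: "nat \<times> hedge \<Rightarrow> nat" where
  "src (l, u, v, Q) = 15 * (l - 1) + u"

fun tgt :: "nat \<times> hedge \<Rightarrow> nat" where
  "tgt (l, u, v, Q) = 15 * (l - 1) + v"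

fun bend :: "nat \<times> hedge \<Rightarrow> pt" where
  "bend (l, u, v, Q) = shift_pt (l - 1) (real_pt Q)"

lemma weight_site: "j < 20 \<Longrightarrow> weight (site j) = 1"
  using weight_sites by (simp add: list_all_iff)

lemma real_pt_site_shift:
  assumes "j < 5"
  shows "real_pt (site (15 + j)) = (-30) *\<^sub>R real_pt (site j)"
proof -
  obtain x y w x' y' w' where s: "site j = (x, y, w)" "site (15 + j) = (x', y', w')"
    by (cases "site j"; cases "site (15 + j)") blast
  have "x' = -30 * x" "y' = -30 * y"
    using site_shift[unfolded list_all_iff, THEN bspec, of j] assms s by simp_all
  moreover have "w = 1" "w' = 1"
    using weight_site[of j] weight_site[of "15 + j"] assms s by auto
  ultimately show ?thesis unfolding s by simp
qed

lemma pos_shift: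
  assumes "j < 20"
  shows "pos (15 * k + j) = shift_pt k (real_pt (site j))"
proof (cases "j < 15")
  case True
  then show ?thesis by (simp add: pos_def)
next
  case False
  obtain i where i: "j = 15 + i" "i < 5"
    using that[of "j - 15"] False assms by simp
  have "15 * k + j = i + 15 * Suc k" using i(1) by simp
  then have "(15 * k + j) div 15 = Suc k" "(15 * k + j) mod 15 = i"
    using i(2) by (simp_all only: div_mult_self2 mod_mult_self2) simp_all
  then have "pos (15 * k + j) = shift_pt (Suc k) (real_pt (site i))"
    by (simp only: pos_def)
  then show ?thesis by (simp only: i real_pt_site_shift shift_pt_def) simp
qed

lemma unshift_shift [simp]: "unshift_pt k (shift_pt k x) = x"
  by (simp add: unshift_pt_def shift_pt_def)

lemma unshift_Suc: "unshift_pt (Suc k) x = inverse (-30) *\<^sub>R unshift_pt k x"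
  by (simp add: unshift_pt_def)

lemma unshift_add: "unshift_pt (k + j) x = unshift_pt j (unshift_pt k x)"
  by (simp add: unshift_pt_def power_add)

lemma unshift_closed_segment:
  assumes "x \<in> closed_segment (shift_pt k a) (shift_pt k b)"
  shows "unshift_pt k x \<in> closed_segment a b"
proof -
  obtain t where t: "0 \<le> t" "t \<le> 1" "x = (1 - t) *\<^sub>R shift_pt k a + t *\<^sub>R shift_pt k b"
    using assms by (auto simp: in_segment)
  have "x = shift_pt k ((1 - t) *\<^sub>R a + t *\<^sub>R b)"
    unfolding t(3) shift_pt_def by (simp add: algebra_simps)
  then have "unshift_pt k x = (1 - t) *\<^sub>R a + t *\<^sub>R b" by simp
  then show ?thesis using t(1,2) unfolding in_segment by blast
qed

lemma shift_unshift: "unshift_pt k x = y \<Longrightarrow> x = shift_pt k y"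
  by (auto simp: unshift_pt_def shift_pt_def)

section \<open>Separation of the copies by pentagons\<close>

definition enclosed :: "pt \<Rightarrow> bool" where
  "enclosed z \<longleftrightarrow> (\<forall>L \<in> set walls. affine_val L z \<le> 0)"

text \<open>Both \<open>enclosed\<close> and \<open>beyond\<close> include the pentagon itself,
  where consecutive layers meet.\<close>

definition beyond :: "pt \<Rightarrow> bool" where
  "beyond z \<longleftrightarrow> (\<exists>L \<in> set walls. 0 \<le> affine_val L z)"

lemma affine_val_segment:
  "affine_val L ((1 - t) *\<^sub>R a + t *\<^sub>R b) = (1 - t) * affine_val L a + t * affine_val L b"
  by (cases L; cases a; cases b) (simp add: algebra_simps)

lemma affine_val_real_pt:
  "0 < weight P \<Longrightarrow> affine_val L (real_pt P) = of_int (hval L P) / of_int (weight P)"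
  by (cases L; cases P) (simp add: field_simps)

lemma real_pt_shrink: "real_pt (shrink P) = inverse (-30) *\<^sub>R real_pt P"
  by (cases P) simp

lemma weight_shrink: "weight (shrink P) = 30 * weight P"
  by (cases P) simp

text \<open>The reflected pentagon fits strictly inside the thirtyfold one; for each wall this
  follows linearly from the five inequalities.\<close>

lemma enclosed_shrink_not_beyond:
  assumes "enclosed z"
  shows "\<not> beyond (inverse (-30) *\<^sub>R z)"
  using assms by (cases z) (auto simp: enclosed_def beyond_def walls_def)

lemma enclosed_unshift: "enclosed z \<Longrightarrow> enclosed (unshift_pt k z)"
proof (induction k)
  case 0
  then show ?case by (simp add: unshift_pt_def)
next
  case (Suc k)
  then show ?case
    using enclosed_shrink_not_beyond[of "unshift_pt k z"]
    by (auto simp: enclosed_def beyond_def unshift_Suc not_le intro: less_imp_le)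
qed

lemma enclosed_not_beyond_unshift:
  assumes "enclosed z" "0 < k"
  shows "\<not> beyond (unshift_pt k z)"
proof -
  obtain j where "k = Suc j" using assms(2) gr0_conv_Suc by blast
  then show ?thesis
    using enclosed_shrink_not_beyond[OF enclosed_unshift[OF assms(1), of j]] by (simp add: unshift_Suc)
qed

lemma leg_outside_beyond:
  assumes "leg_outside P Q" "0 < weight P" "0 < weight Q" "z \<in> closed_segment (real_pt P) (real_pt Q)"
  shows "beyond z"
proof -
  obtain L where L: "L \<in> set walls" "0 \<le> hval L P" "0 \<le> hval L Q"
    using assms(1) by (auto simp: leg_outside_def list_ex_iff)
  obtain t where t: "0 \<le> t" "t \<le> 1" "z = (1 - t) *\<^sub>R real_pt P + t *\<^sub>R real_pt Q"
    using assms(4) by (auto simp: in_segment)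
  have "0 \<le> affine_val L (real_pt P)" "0 \<le> affine_val L (real_pt Q)"
    using L assms(2,3) by (simp_all add: affine_val_real_pt)
  then have "0 \<le> affine_val L z" unfolding t(3) affine_val_segment using t(1,2) by simp
  then show ?thesis using L(1) unfolding beyond_def by blast
qed

lemma leg_inside_enclosed:
  assumes "leg_inside P Q" "0 < weight P" "0 < weight Q" "z \<in> closed_segment (real_pt P) (real_pt Q)"
  shows "enclosed z" and "beyond z \<Longrightarrow> z = real_pt P"
proof -
  obtain t where t: "0 \<le> t" "t \<le> 1" "z = (1 - t) *\<^sub>R real_pt P + t *\<^sub>R real_pt Q"
    using assms(4) by (auto simp: in_segment)
  have L: "affine_val L (real_pt P) \<le> 0" "affine_val L (real_pt Q) < 0" if "L \<in> set walls" for L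
    using assms(1-3) that
    by (auto simp: leg_inside_def list_all_iff affine_val_real_pt divide_nonpos_pos divide_neg_pos)
  have le: "(1 - t) * affine_val L (real_pt P) \<le> 0" "t * affine_val L (real_pt Q) \<le> 0"
    if "L \<in> set walls" for L
    using L[OF that] t(1,2) by (auto simp: mult_nonneg_nonpos)
  show "enclosed z"
    unfolding enclosed_def t(3) affine_val_segment using le by (auto intro: add_nonpos_nonpos)
  assume "beyond z"
  then obtain M where M: "M \<in> set walls" "0 \<le> affine_val M z" unfolding beyond_def by blast
  \<comment> \<open>Two nonpositive summands with nonnegative sum both vanish, and the value at the
    bend is negative.\<close>
  then have "t * affine_val M (real_pt Q) = 0"
    using le[OF M(1)] unfolding t(3) affine_val_segment by linarith
  then have "t = 0" using L(2)[OF M(1)] by simp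
  then show "z = real_pt P" using t(3) by simp
qed

text \<open>A vertex lies on or outside the inner pentagon of its copy and strictly inside the outer
  one. This determines the copy, and sites 0--14 are distinct.\<close>

lemma inj_pos: "inj pos"
proof (rule injI)
  fix v w assume eq: "pos v = pos w"
  have low: "beyond (unshift_pt (v div 15) (pos v))" "enclosed (unshift_pt (Suc (v div 15)) (pos v))"
    "\<not> beyond (unshift_pt (Suc (v div 15)) (pos v))" for v
  proof -
    let ?P = "site (v mod 15)"
    have j: "v mod 15 < 15" by simp
    then have wt: "weight ?P = 1" by (intro weight_site) simp
    have ok: "leg_outside ?P ?P" "leg_inside (shrink ?P) (shrink ?P)"
      using sites_in_layer j by (auto simp: list_all_iff)
    show "beyond (unshift_pt (v div 15) (pos v))"
      using leg_outside_beyond[OF ok(1)] wt by (simp add: pos_def)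
    have u: "unshift_pt (Suc (v div 15)) (pos v) = real_pt (shrink ?P)"
      unfolding unshift_Suc real_pt_shrink pos_def by simp
    show "enclosed (unshift_pt (Suc (v div 15)) (pos v))"
      unfolding u using leg_inside_enclosed(1)[OF ok(2)] wt by (simp add: weight_shrink)
    show "\<not> beyond (unshift_pt (Suc (v div 15)) (pos v))"
      unfolding u using ok(2) wt
      by (auto simp: beyond_def leg_inside_def list_all_iff affine_val_real_pt weight_shrink not_le divide_neg_pos)
  qed
  have no: "\<not> v div 15 < w div 15" if "pos v = pos w" for v w
  proof
    assume less: "v div 15 < w div 15"
    then obtain k where k: "w div 15 = Suc (v div 15) + k"
      using less_iff_Suc_add by auto
    have "beyond (unshift_pt k (unshift_pt (Suc (v div 15)) (pos v)))"
      using low(1)[of w] unfolding k unshift_add that .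
    \<comment> \<open>For \<open>k = 0\<close> strictness at the outer pentagon gives the
      contradiction, for \<open>k > 0\<close> enclosure does.\<close>
    then show False
      using enclosed_not_beyond_unshift[OF low(2)[of v], of k] low(3)[of v]
      by (cases "k = 0") (auto simp: unshift_pt_def)
  qed
  have d: "v div 15 = w div 15" using no[OF eq] no[OF eq[symmetric]] by linarith
  have "real_pt (site (v mod 15)) = real_pt (site (w mod 15))"
    using arg_cong[OF eq, of "unshift_pt (v div 15)"] d by (simp add: pos_def)
  moreover have "weight (site (v mod 15)) = 1" "weight (site (w mod 15)) = 1"
    by (intro weight_site; simp add: less_trans[OF mod_less_divisor])+
  ultimately have "site (v mod 15) = site (w mod 15)"
    by (cases "site (v mod 15)"; cases "site (w mod 15)") simp
  then have "v mod 15 = w mod 15"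
    using distinct_sites by (auto simp: distinct_map inj_on_def)
  with d show "v = w" by (metis div_mult_mod_eq)
qed

section \<open>Compatibility within one layer\<close>

lemma layer_wf:
  assumes "(u, v, Q) \<in> set (layer m l)"
  shows "u < 20" "v < 20" "u \<noteq> v" "0 < weight Q" "hbend_ok (site u) Q (site v)"
    and "l = 0 \<or> m < l \<Longrightarrow> u < 5 \<and> v < 5"
  using assms wf_ring wf_caps unfolding wf_edges_def list_all_iff
  by (auto simp: layer_def split: if_splits)

lemma pairs_ok_layer: "pairs_ok (map legs (layer m l))"
  using pairs_ok_ring pairs_ok_caps by (simp add: layer_def)

lemma compatible_same_layer:
  assumes "(l, e) \<in> edges m" "(l, f) \<in> edges m" "e \<noteq> f"
    and "a \<in> {src (l, e), tgt (l, e)}" "b \<in> {src (l, f), tgt (l, f)}"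
  shows "compatible pos a (bend (l, e)) b (bend (l, f))"
proof -
  have *: "compatible pos a (bend (l, e)) b (bend (l, f))"
    if ok: "edge_ok (legs e) (legs f)" and e: "e \<in> set (layer m l)" and f: "f \<in> set (layer m l)"
      and a: "a \<in> {src (l, e), tgt (l, e)}" and b: "b \<in> {src (l, f), tgt (l, f)}" for e f a b
  proof -
    obtain u v Q u' v' Q' where ef: "e = (u, v, Q)" "f = (u', v', Q')"
      by (cases e; cases f) blast
    note wf = layer_wf[OF e[unfolded ef]] layer_wf[OF f[unfolded ef]]
    have c: "compatible pos (15 * (l - 1) + i) (bend (l, e)) (15 * (l - 1) + j) (bend (l, f))"
      if "leg_ok (leg i Q) (leg j Q')" "i < 20" "j < 20" for i j
    proof -
      have "compatible pos (15 * (l - 1) + i) (((-30) ^ (l - 1)) *\<^sub>R real_pt Q)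
          (15 * (l - 1) + j) (((-30) ^ (l - 1)) *\<^sub>R real_pt Q')"
      proof (rule compatible_if_leg_ok)
        show "leg_ok (i, site i, Q, hline (site i) Q) (j, site j, Q', hline (site j) Q')"
          using that(1) by (simp only: leg_def)
        show "pos (15 * (l - 1) + i) = ((-30) ^ (l - 1)) *\<^sub>R real_pt (site i)"
          "pos (15 * (l - 1) + j) = ((-30) ^ (l - 1)) *\<^sub>R real_pt (site j)"
          using that(2,3) by (simp_all only: pos_shift shift_pt_def)
      qed (use wf that(2,3) weight_site in auto)
      then show ?thesis by (simp add: ef shift_pt_def)
    qed
    have "leg_ok (leg u Q) (leg u' Q')" "leg_ok (leg u Q) (leg v' Q')"
      "leg_ok (leg v Q) (leg u' Q')" "leg_ok (leg v Q) (leg v' Q')"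
      using ok unfolding ef by (simp_all del: leg_ok.simps split: if_splits)
    then show ?thesis
      using a b c wf(1,2,7,8) unfolding ef by auto
  qed
  have ef: "e \<in> set (layer m l)" "f \<in> set (layer m l)" using assms(1,2) by (auto simp: edges_def)
  from pairs_ok_map_legsD[OF pairs_ok_layer ef assms(3)] show ?thesis
    using *[OF _ ef assms(4,5)] *[OF _ ef(2,1) assms(5,4)] compatible_commute by blast
qed

lemma edge_proper_bend:
  assumes "i \<in> edges m"
  shows "proper_bend (pos (src i)) (bend i) (pos (tgt i))"
proof -
  obtain l u v Q where i: "i = (l, u, v, Q)" by (cases i) blast
  have "(u, v, Q) \<in> set (layer m l)" using assms i by (simp add: edges_def)
  note wf = layer_wf[OF this]
  show ?thesis
    unfolding i src.simps tgt.simps bend.simps pos_shift[OF wf(1)] pos_shift[OF wf(2)] shift_pt_def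
    using wf weight_site by (intro proper_bend_if_hbend_ok) auto
qed

text \<open>Besides covering all vertices, this supplies an edge of the outer layer at each vertex
  of a pentagon between two layers.\<close>

lemma covered_in_layer:
  assumes "0 < l" "l \<le> Suc m" "j < 5 \<or> l \<le> m \<and> j < 15"
  shows "\<exists>e. (l, e) \<in> edges m \<and> 15 * (l - 1) + j \<in> {src (l, e), tgt (l, e)}"
proof -
  have "incident j (layer m l)"
    using incident_layers assms by (auto simp: layer_def list_all_iff)
  then obtain u v Q where "(u, v, Q) \<in> set (layer m l)" "j = u \<or> j = v"
    by (auto simp: incident_def list_ex_iff)
  then show ?thesis
    using assms(2) by (intro exI[of _ "(u, v, Q)"]) (auto simp: edges_def)
qed

section \<open>Edges of different layers\<close>

lemma leg_beyond:
  assumes "i \<in> edges m" "fst i = Suc k" "a \<in> {src i, tgt i}" "x \<in> closed_segment (pos a) (bend i)"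
  shows "beyond (unshift_pt k x)"
proof -
  obtain u v Q where i: "i = (Suc k, u, v, Q)" using assms(2) by (cases i) auto
  have e: "(u, v, Q) \<in> set (layer m (Suc k))" using assms(1) i by (simp add: edges_def)
  note wf = layer_wf[OF e]
  have out: "leg_outside (site u) Q" "leg_outside (site v) Q"
    using e layers_outside by (auto simp: layer_def list_all_iff split: if_splits)
  obtain j where j: "a = 15 * k + j" "j < 20" "leg_outside (site j) Q"
    using assms(3) out wf(1,2) unfolding i by auto
  have "x \<in> closed_segment (shift_pt k (real_pt (site j))) (shift_pt k (real_pt Q))"
    using assms(4) unfolding i j(1) pos_shift[OF j(2)] by simp
  from leg_outside_beyond[OF j(3) _ _ unshift_closed_segment[OF this]]
  show ?thesis using wf(4) weight_site[OF j(2)] by simp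
qed

text \<open>The pentagon between layers \<open>l\<close> and \<open>l + 1\<close> encloses layer
  \<open>l\<close>, which touches it only at its corners, the first five vertices of copy
  \<open>l\<close>.\<close>

lemma leg_enclosed:
  assumes "i \<in> edges m" "fst i = l" "l \<le> m" "a \<in> {src i, tgt i}" "x \<in> closed_segment (pos a) (bend i)"
  shows "enclosed (unshift_pt l x)"
    and "beyond (unshift_pt l x) \<Longrightarrow> x = pos a \<and> (\<exists>j<5. a = 15 * l + j)"
proof -
  obtain u v Q where i: "i = (l, u, v, Q)" using assms(2) by (cases i) auto
  have e: "(u, v, Q) \<in> set (layer m l)" using assms(1) i by (simp add: edges_def)
  note wf = layer_wf[OF e]
  have "enclosed (unshift_pt l x) \<and> (beyond (unshift_pt l x) \<longrightarrow> x = pos a \<and> (\<exists>j<5. a = 15 * l + j))"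
  proof (cases l)
    case 0
    have "leg_inside (site u) Q" "leg_inside (site v) Q"
      using e layers_inside(1) 0 by (auto simp: layer_def list_all_iff)
    then have a: "a < 5" "leg_inside (site a) Q"
      using assms(4) wf(6) 0 unfolding i by auto
    then have pa: "pos a = real_pt (site a)" by (simp add: pos_def shift_pt_def)
    have "x \<in> closed_segment (real_pt (site a)) (real_pt Q)"
      using assms(5) unfolding i pa 0 by (simp add: shift_pt_def)
    note * = leg_inside_enclosed[OF a(2) _ wf(4) this]
    have "unshift_pt l x = x" by (simp add: 0 unshift_pt_def)
    then show ?thesis using * a(1) weight_site[of a] pa 0 by auto
  next
    case (Suc k)
    have ins: "leg_inside (shrink (site u)) (shrink Q)" "leg_inside (shrink (site v)) (shrink Q)"
      using e layers_inside(2) Suc assms(3) by (auto simp: layer_def list_all_iff)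
    obtain j where j: "a = 15 * k + j" "j < 20" "leg_inside (shrink (site j)) (shrink Q)"
      using assms(4) ins wf(1,2) unfolding i Suc by auto
    have wj: "weight (site j) = 1" by (rule weight_site[OF j(2)])
    have "x \<in> closed_segment (shift_pt k (real_pt (site j))) (shift_pt k (real_pt Q))"
      using assms(5) unfolding i j(1) pos_shift[OF j(2)] Suc by simp
    then obtain t where t: "0 \<le> t" "t \<le> 1"
        "unshift_pt k x = (1 - t) *\<^sub>R real_pt (site j) + t *\<^sub>R real_pt Q"
      using unshift_closed_segment in_segment(1) by metis
    have "unshift_pt l x = (1 - t) *\<^sub>R real_pt (shrink (site j)) + t *\<^sub>R real_pt (shrink Q)"
      unfolding Suc unshift_Suc real_pt_shrink t(3) scaleR_add_right scaleR_scaleR by (simp only: mult.commute)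
    then have "unshift_pt l x \<in> closed_segment (real_pt (shrink (site j))) (real_pt (shrink Q))"
      using t(1,2) unfolding in_segment by blast
    note * = leg_inside_enclosed[OF j(3) _ _ this]
    have win: "enclosed (unshift_pt l x)" using * wj wf(4) by (simp add: weight_shrink)
    have "x = pos a \<and> (\<exists>j<5. a = 15 * l + j)" if b: "beyond (unshift_pt l x)"
    proof -
      have eq: "unshift_pt l x = real_pt (shrink (site j))"
        using *(2)[OF _ _ b] wj wf(4) by (simp add: weight_shrink)
      then have "unshift_pt k x = real_pt (site j)"
        unfolding Suc unshift_Suc real_pt_shrink by simp
      then have "x = shift_pt k (real_pt (site j))" by (rule shift_unshift)
      then have "x = pos a" by (simp only: j(1) pos_shift[OF j(2)])
      \<comment> \<open>Sites 0--14 are strictly inside the outer pentagon, so the vertex is one of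
        the sites 15--19.\<close>
      moreover have "\<not> j < 15"
      proof
        assume "j < 15"
        then have "leg_inside (shrink (site j)) (shrink (site j))"
          using sites_in_layer by (auto simp: list_all_iff)
        then show False
          using b wj unfolding eq
          by (auto simp: beyond_def leg_inside_def list_all_iff affine_val_real_pt weight_shrink
              zero_le_divide_iff)
      qed
      then have "a = 15 * l + (j - 15)" "j - 15 < 5" using j Suc by auto
      ultimately show ?thesis by blast
    qed
    with win show ?thesis by blast
  qed
  then show "enclosed (unshift_pt l x)"
    and "beyond (unshift_pt l x) \<Longrightarrow> x = pos a \<and> (\<exists>j<5. a = 15 * l + j)" by blast+
qed

text \<open>The first leg lies within pentagon \<open>l\<close>, the second not inside pentagon
  \<open>l + r\<close>. So they meet only for \<open>r = 0\<close>, and then in a corner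
  \<open>a\<close> of the pentagon between the layers; it remains to identify \<open>a\<close> with
  \<open>b\<close>.\<close>

lemma compatible_lower_layer:
  assumes i: "i \<in> edges m" and j: "j \<in> edges m" and less: "fst i < fst j"
    and a: "a \<in> {src i, tgt i}" and b: "b \<in> {src j, tgt j}"
  shows "compatible pos a (bend i) b (bend j)"
  unfolding compatible_def
proof
  fix x assume x: "x \<in> closed_segment (pos a) (bend i) \<inter> closed_segment (pos b) (bend j)"
  define l where "l = fst i"
  obtain r where r: "fst j = Suc (l + r)" using less less_iff_Suc_add unfolding l_def by auto
  have jm: "fst j \<le> Suc m" using j by (auto simp: edges_def)
  have lm: "l \<le> m" using jm r by simp
  note win = leg_enclosed[OF i l_def[symmetric] lm a]
  have bey: "beyond (unshift_pt r (unshift_pt l x))"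
    using leg_beyond[OF j r b] x by (simp add: unshift_add)
  have "r = 0" using enclosed_not_beyond_unshift[of "unshift_pt l x" r] win(1) x bey by blast
  then have "beyond (unshift_pt l x)" using bey by (simp add: unshift_pt_def)
  then obtain k where k: "x = pos a" "k < 5" "a = 15 * l + k" using win(2) x by blast
  have l': "fst j = Suc l" using r \<open>r = 0\<close> by simp
  have "a = b"
  proof (rule ccontr)
    assume "a \<noteq> b"
    obtain f where f: "j = (Suc l, f)" using l' by (cases j) auto
    \<comment> \<open>An edge at \<open>a\<close> in the layer of \<open>j\<close> reduces the claim
      to that single layer.\<close>
    obtain e where e: "(Suc l, e) \<in> edges m" "a \<in> {src (Suc l, e), tgt (Suc l, e)}"
      using covered_in_layer[of "Suc l" m k] k lm by auto
    show False
    proof (cases "e = f")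
      case False
      have "compatible pos a (bend (Suc l, e)) b (bend j)"
        using compatible_same_layer[of "Suc l" e m f a b] e False j b f by auto
      then show False using compatible_vertex_on_leg[of pos a _ b] x k(1) \<open>a \<noteq> b\<close> by blast
    next
      case True
      \<comment> \<open>Now \<open>a\<close> and \<open>b\<close> are the two ends of
        \<open>j\<close>, so \<open>pos a\<close> lies on both legs of \<open>j\<close> and would be
        its bend.\<close>
      have pb: "proper_bend (pos (src j)) (bend j) (pos (tgt j))" using j by (rule edge_proper_bend)
      have "a \<in> {src j, tgt j}" using e(2) f True by simp
      then have "pos a \<in> closed_segment (pos (src j)) (bend j) \<inter> closed_segment (bend j) (pos (tgt j))"
        using b \<open>a \<noteq> b\<close> x k(1) by (auto simp: closed_segment_commute)
      then have "pos a = bend j" unfolding proper_bend_inter[OF pb] by simp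
      then show False using proper_bend_neq[OF pb] \<open>a \<in> {src j, tgt j}\<close> by auto
    qed
  qed
  then show "a = b \<and> x = pos a \<or> x \<in> open_segment (pos a) (bend i) \<and> x \<in> open_segment (pos b) (bend j) \<and>
      perp (pos a - bend i) (pos b - bend j)"
    using k(1) by simp
qed

lemma compatible_edges:
  assumes "i \<in> edges m" "j \<in> edges m" "i \<noteq> j" "a \<in> {src i, tgt i}" "b \<in> {src j, tgt j}"
  shows "compatible pos a (bend i) b (bend j)"
proof (cases "fst i" "fst j" rule: linorder_cases)
  case less
  then show ?thesis using compatible_lower_layer assms by blast
next
  case greater
  then show ?thesis using compatible_lower_layer assms compatible_commute by blast
next
  case equal
  then obtain l e f where ij: "i = (l, e)" "j = (l, f)" by (metis prod.collapse)
  then have "e \<noteq> f" using assms(3) by blast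
  with assms(1,2,4,5) show ?thesis unfolding ij by (intro compatible_same_layer)
qed

section \<open>Counting vertices and edges\<close>

lemma inj_on_ends:
  assumes "0 < m"
  shows "inj_on (\<lambda>i. {src i, tgt i}) (edges m)"
proof -
  define lo where "lo i = min (src i) (tgt i)" for i
  define hi where "hi i = max (src i) (tgt i)" for i
  have lohi: "lo (l, e) = 15 * (l - 1) + fst (sorted_ends e)" "hi (l, e) = 15 * (l - 1) + snd (sorted_ends e)"
    for l e by (cases e; simp add: lo_def hi_def)+
  have low: "fst (sorted_ends e) < 15" if "(l, e) \<in> edges m" for l e
  proof -
    obtain u v Q where e: "e = (u, v, Q)" by (cases e) blast
    have "e \<in> set (layer m l)" using that by (simp add: edges_def)
    then show ?thesis
      using layer_wf(6)[of u v Q m l] ring_touches_low e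
      by (auto simp: list_all_iff layer_def split: if_splits)
  qed
  \<comment> \<open>The smaller end reveals the scale, but does not tell layer 0 from layer
    1.\<close>
  have sc: "l - 1 = lo (l, e) div 15" if "(l, e) \<in> edges m" for l e
    using low[OF that] by (simp add: lohi)
  have eq: "i = j" if i: "i \<in> edges m" and j: "j \<in> edges m" and le: "fst i \<le> fst j"
    and ends: "{src i, tgt i} = {src j, tgt j}" for i j
  proof -
    obtain l e l' f where ij: "i = (l, e)" "j = (l', f)" by (cases i; cases j) blast
    have lh: "lo i = lo j" "hi i = hi j"
      using ends unfolding lo_def hi_def doubleton_eq_iff by auto
    have l1: "l - 1 = l' - 1" using sc i j lh(1) unfolding ij by simp
    have se: "sorted_ends e = sorted_ends f"
      using lh l1 unfolding ij lohi by (simp add: prod_eq_iff)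
    have mem: "e \<in> set (layer m l)" "f \<in> set (layer m l')" using i j ij by (auto simp: edges_def)
    show ?thesis
    proof (cases "l = l'")
      case True
      have "distinct (map sorted_ends (layer m l))"
        using wf_ring wf_caps by (simp add: wf_edges_def layer_def)
      then have "e = f" using mem se True by (auto simp: distinct_map inj_on_def)
      then show ?thesis using ij True by simp
    next
      case False
      \<comment> \<open>By \<open>0 < m\<close> layer 1 is a ring; an outer cap there would repeat
        the diagonals of the inner cap.\<close>
      then have "l = 0" "l' = 1" using l1 le ij by auto
      then have "e \<in> set inner_cap" "f \<in> set ring" using mem assms by (auto simp: layer_def)
      then show ?thesis using inner_cap_ring_disjoint se by (auto simp: list_all_iff)
    qed
  qed
  show ?thesis
  proof (rule inj_onI)
    fix i j assume "i \<in> edges m" "j \<in> edges m" "{src i, tgt i} = {src j, tgt j}"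
    then show "i = j" using eq[of i j] eq[of j i] by (cases "fst i \<le> fst j") auto
  qed
qed

lemma card_edges: "card (edges m) = 75 * m + 15"
proof -
  have "distinct inner_cap" "distinct ring" "distinct outer_cap"
    using wf_ring wf_caps by (auto simp: wf_edges_def distinct_map)
  then have c: "card (set inner_cap) = 5" "card (set ring) = 75" "card (set outer_cap) = 10"
    by (simp_all add: distinct_card length_layers)
  have "{..Suc m} = insert 0 (insert (Suc m) {1..m})" by auto
  then have "(\<Sum>l\<le>Suc m. card (set (layer m l))) = 75 * m + 15"
    by (simp add: c layer_def)
  then show ?thesis by (simp add: edges_def)
qed

lemma ends_bounded:
  assumes "i \<in> edges m"
  shows "src i \<noteq> tgt i \<and> src i < 15 * m + 5 \<and> tgt i < 15 * m + 5"
proof -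
  obtain l u v Q where i: "i = (l, u, v, Q)" by (cases i) blast
  have l: "l \<le> Suc m" and e: "(u, v, Q) \<in> set (layer m l)" using assms i by (auto simp: edges_def)
  note wf = layer_wf[OF e]
  show ?thesis
  proof (cases "l = 0 \<or> m < l")
    case True
    then show ?thesis using wf(3) wf(6) l unfolding i by auto
  next
    case False
    \<comment> \<open>Site 19 in layer \<open>l\<close> is vertex \<open>15 * l + 4\<close>, hence
      at most \<open>15 * m + 4\<close>.\<close>
    then have "l - 1 + 1 \<le> m" by auto
    then show ?thesis using wf(1-3) unfolding i by auto
  qed
qed

lemma rac1_graph_nested_dodecahedra:
  assumes "0 < m"
  shows "rac1_graph (15 * m + 5) ((\<lambda>i. {src i, tgt i}) ` edges m)"
proof (rule rac1_graph_if_compatible[where p = pos and \<beta> = bend])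
  show "inj_on pos {..<15 * m + 5}" using inj_pos by (rule inj_on_subset) simp
  show "inj_on (\<lambda>i. {src i, tgt i}) (edges m)" using assms by (rule inj_on_ends)
  show "\<exists>i\<in>edges m. w \<in> {src i, tgt i}" if "w < 15 * m + 5" for w
  proof -
    have "w div 15 \<le> m" using that by (simp add: less_Suc_eq_le[symmetric] div_less_iff_less_mult)
    \<comment> \<open>The last copy has only its first five vertices, which the outer cap
      covers.\<close>
    moreover have "w mod 15 < 5 \<or> Suc (w div 15) \<le> m"
      using that \<open>w div 15 \<le> m\<close> by (cases "w div 15 = m") (auto simp: minus_mult_div_eq_mod[symmetric])
    ultimately obtain e where "(Suc (w div 15), e) \<in> edges m"
      "15 * (w div 15) + w mod 15 \<in> {src (Suc (w div 15), e), tgt (Suc (w div 15), e)}"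
      using covered_in_layer[of "Suc (w div 15)" m "w mod 15"] by auto
    then show ?thesis by (intro bexI[of _ "(Suc (w div 15), e)"]) simp_all
  qed
qed (use ends_bounded edge_proper_bend compatible_edges in blast)+

theorem theorem2:
  shows "infinite {n::nat. n > 0 \<and>
           (\<exists>E. rac1_graph n E \<and> int (card E) = 5 * int n - 10)}"
proof -
  \<comment> \<open>\<open>Suc m\<close> provides at least one ring. For k rings, n = 15k + 5 and
    there are 75k + 15 = 5n - 10 edges.\<close>
  have "(\<lambda>m. 15 * Suc m + 5) ` UNIV \<subseteq> {n. n > 0 \<and> (\<exists>E. rac1_graph n E \<and> int (card E) = 5 * int n - 10)}"
  proof (intro image_subsetI CollectI conjI exI)
    fix m :: nat
    show "rac1_graph (15 * Suc m + 5) ((\<lambda>i. {src i, tgt i}) ` edges (Suc m))"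
      by (rule rac1_graph_nested_dodecahedra) simp
    show "int (card ((\<lambda>i. {src i, tgt i}) ` edges (Suc m))) = 5 * int (15 * Suc m + 5) - 10"
      by (simp add: card_image inj_on_ends card_edges)
  qed simp
  moreover have "infinite (range (\<lambda>m::nat. 15 * Suc m + 5))"
    by (rule range_inj_infinite) (simp add: inj_on_def)
  ultimately show ?thesis by (rule infinite_super)
qed

end
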